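(* There exists a graph property $\mathcal{S}_0$ (on the vertex set $\mathbb{N}$) that is $\infty$-elusive but not elusive.
   Context: Let $[\mathbb{N}]^2=\{\{n,k\}: n,k\in\mathbb{N},\ n\neq k\}$. A graph on $\mathbb{N}$ is a subset $G\subseteq[\mathbb{N}]^2$, identified with its characteristic function, so the set of graphs is $2^{[\mathbb{N}]^2}$. A graph property is an isomorphism-invariant subset $\mathcal{S}\subseteq 2^{[\mathbb{N}]^2}$. The infinite game $G(\mathcal{S})$. Two players, Seeker and Hider, colour the edges of the complete graph on $\mathbb{N}$ with red, white, green. Initially all edges are white. In each turn Seeker picks a white edge and Hider recolours it green or red. The game terminates after infinitely many (that is, $\omega$ many) turns. Let $R_\infty,W_\infty,G_\infty$ be the sets of red, white and green edges at the end, and let $\mathcal{P}_\infty=\{G\subseteq[\mathbb{N}]^2: G_\infty\subseteq G\subseteq G_\infty\cup W_\infty\}$. Seeker wins if and only if $W_\infty\neq\emptyset$ and either $\mathcal{P}_\infty\subseteq\mathcal{S}$ or $\mathcal{P}_\infty\subseteq 2^{[\mathbb{N}]^2}\setminus\mathcal{S}$; otherwise Hider wins. The property $\mathcal{S}$ is $\infty$-elusive if Seeker does not have a winning strategy in $G(\mathcal{S})$. The transfinite game. The players play by the same rules, but turns are numbered by ordinals and the play continues past limit ordinals (an edge coloured at an earlier turn keeps its colour, all other edges are white) as long as there are white edges. For an ordinal $\alpha$ let $R_\alpha,W_\alpha,G_\alpha$ be the sets of red, white and green edges after $\alpha$ turns and $\mathcal{P}_\alpha=\{G: G_\alpha\subseteq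 G\subseteq G_\alpha\cup W_\alpha\}$. Seeker wins if for some ordinal $\alpha$ reached in the play, $W_\alpha\neq\emptyset$ and either $\mathcal{P}_\alpha\subseteq\mathcal{S}$ or $\mathcal{P}_\alpha\subseteq 2^{[\mathbb{N}]^2}\setminus\mathcal{S}$; otherwise (all edges get coloured without this ever happening) Hider wins. The property $\mathcal{S}$ is elusive if Seeker does not have a winning strategy in the transfinite game; thus "not elusive" means that Seeker has a winning strategy in the transfinite game. *)

theory Defs
  imports Main
begin

section \<open>Graph properties\<close>

type_synonym edge = "nat set"
type_synonym graph = "edge set"

definition edges :: "edge set" where
  "edges = {{n, k} | n k. n \<noteq> k}"

definition graph_property :: "graph set \<Rightarrow> bool" where
  "graph_property S \<longleftrightarrow>
     S \<subseteq> Pow edges \<and> (\<forall>\<pi> G. bij \<pi> \<and> G \<in> S \<longrightarrow> (\<lambda>e. \<pi> ` e) ` G \<in> S)"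

section \<open>Turns and colourings\<close>

text \<open>
  A turn consists of the edge picked by Seeker and the colour given to it by Hider.
  The colouring of the board is represented by the set \<open>T\<close> of the turns played so far;
  the edges that do not occur in \<open>T\<close> are white.
\<close>

datatype colour = Red | Green

type_synonym turn = "edge \<times> colour"

definition green :: "turn set \<Rightarrow> edge set" where
  "green T = {e. (e, Green) \<in> T}"

definition white :: "turn set \<Rightarrow> edge set" where
  "white T = edges - fst ` T"

definition completions :: "turn set \<Rightarrow> graph set" where
  "completions T = {G. green T \<subseteq> G \<and> G \<subseteq> green T \<union> white T}"

definition decided :: "graph set \<Rightarrow> turn set \<Rightarrow> bool" where
  "decided S T \<longleftrightarrow>
     white T \<noteq> {} \<and> (completions T \<subseteq> S \<or> completions T \<subseteq> Pow edges - S)"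

section \<open>The infinite game\<close>

text \<open>
  A strategy of Seeker maps each finite history (the list of the turns played so far,
  in chronological order) to the edge to be picked next.
\<close>

type_synonym strategy = "turn list \<Rightarrow> edge"

definition history :: "strategy \<Rightarrow> turn list \<Rightarrow> bool" where
  "history \<sigma> h \<longleftrightarrow>
     (\<forall>n < length h. fst (h ! n) \<in> white (set (take n h)) \<and> fst (h ! n) = \<sigma> (take n h))"

text \<open>
  The colours in a play are unconstrained, so quantifying over all plays that follow a strategy
  is quantifying over all ways in which Hider can answer it. Legality rules out that a strategy
  wins vacuously by picking an edge that is not white.
\<close>

definition legal :: "strategy \<Rightarrow> bool" where
  "legal \<sigma> \<longleftrightarrow> (\<forall>h. history \<sigma> h \<longrightarrow> \<sigma> h \<in> white (set h))"

definition play :: "strategy \<Rightarrow> (nat \<Rightarrow> turn) \<Rightarrow> bool" where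
  "play \<sigma> p \<longleftrightarrow> (\<forall>n. history \<sigma> (map p [0..<n]))"

definition winning_strategy :: "graph set \<Rightarrow> strategy \<Rightarrow> bool" where
  "winning_strategy S \<sigma> \<longleftrightarrow> legal \<sigma> \<and> (\<forall>p. play \<sigma> p \<longrightarrow> decided S (range p))"

definition infinity_elusive :: "graph set \<Rightarrow> bool" where
  "infinity_elusive S \<longleftrightarrow> \<not> (\<exists>\<sigma>. winning_strategy S \<sigma>)"

section \<open>The transfinite game\<close>

text \<open>
  Every edge is picked at most once, so no turn occurs twice in a history. Hence a history of
  ordinal length \<open>\<alpha>\<close>, that is, an injective \<open>\<alpha>\<close>-sequence of turns, is the same as a (reflexive)
  well-order \<open>r\<close> of order type \<open>\<alpha>\<close> on the set \<open>Field r\<close> of its turns, which lists them in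
  chronological order. No bound on \<open>\<alpha>\<close> is imposed.
  The histories after \<open>\<beta>\<close> turns, for the ordinals \<open>\<beta> \<le> \<alpha>\<close>, are the restrictions of \<open>r\<close> to its
  initial segments (\<^const>\<open>ofilter\<close>), including the empty one and \<open>Field r\<close> itself; the history
  immediately before the turn \<open>t\<close> is the restriction to \<open>underS r t\<close>.
\<close>

type_synonym transfinite_strategy = "turn rel \<Rightarrow> edge"

definition transfinite_history :: "transfinite_strategy \<Rightarrow> turn rel \<Rightarrow> bool" where
  "transfinite_history \<tau> r \<longleftrightarrow>
     Well_order r \<and>
     (\<forall>t \<in> Field r. fst t \<in> white (underS r t) \<and> fst t = \<tau> (Restr r (underS r t)))"

definition transfinite_legal :: "transfinite_strategy \<Rightarrow> bool" where
  "transfinite_legal \<tau> \<longleftrightarrow>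
     (\<forall>r. transfinite_history \<tau> r \<and> white (Field r) \<noteq> {} \<longrightarrow> \<tau> r \<in> white (Field r))"

text \<open>The play goes on as long as there are white edges.\<close>

definition transfinite_play :: "transfinite_strategy \<Rightarrow> turn rel \<Rightarrow> bool" where
  "transfinite_play \<tau> r \<longleftrightarrow> transfinite_history \<tau> r \<and> white (Field r) = {}"

definition transfinite_winning_strategy :: "graph set \<Rightarrow> transfinite_strategy \<Rightarrow> bool" where
  "transfinite_winning_strategy S \<tau> \<longleftrightarrow>
     transfinite_legal \<tau> \<and>
     (\<forall>r. transfinite_play \<tau> r \<longrightarrow> (\<exists>A. ofilter r A \<and> decided S A))"

definition elusive :: "graph set \<Rightarrow> bool" where
  "elusive S \<longleftrightarrow> \<not> (\<exists>\<tau>. transfinite_winning_strategy S \<tau>)"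

end

theory Submission
  imports Defs
begin

text \<open>
  The property asks a question whose irrelevant edges are revealed only by infinitely many answers.
  Underlying it is a function of the bits \<open>q\<^sub>0, q\<^sub>1, \<dots>\<close>, \<open>p\<close>, \<open>y\<close>: if all \<open>q\<^sub>i\<close> vanish, the value
  depends on \<open>p\<close> but not on \<open>y\<close>; otherwise it depends on \<open>y\<close> and the
  \<open>q\<^sub>i\<close> but not on \<open>p\<close>. Who may wait for
  all \<open>q\<^sub>i\<close> before touching \<open>p\<close> and \<open>y\<close> asks the relevant one and leaves the other. Who has only
  \<open>\<omega>\<close> turns has to ask \<open>p\<close> after finitely many \<open>q\<^sub>i\<close>, or never. If \<open>p\<close> is never asked, the
  answers \<open>q\<^sub>i = 0\<close> make it relevant; as soon as it is asked, Hider answers \<open>1\<close> to the next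
  \<open>q\<^sub>i\<close>, which makes \<open>p\<close> a wasted question and everything else relevant.

  To make this isomorphism invariant, the roles are read off the graph. A centre \<open>b\<close> is the only
  vertex of infinite degree, and all vertices but \<open>b\<close> and three others, the far ones, are its
  neighbours. The pairs within the far set \<open>F\<close> play the role of \<open>p\<close>, the pairs between
  \<open>F\<close> and the neighbours of \<open>b\<close> that of the \<open>q\<^sub>i\<close>, and the pairs of neighbours of \<open>b\<close> that
  of \<open>y\<close>. A graph has the property if no edge meets \<open>F\<close> (and then the edges between neighbours
  of \<open>b\<close> are arbitrary as long as degrees stay finite), or if exactly one edge leaves \<open>F\<close> and no
  edge joins two neighbours of \<open>b\<close> (and then the edges within \<open>F\<close> are arbitrary).

  Against a Seeker with \<open>\<omega>\<close> turns, Hider may fix \<open>b = 0\<close> and \<open>F = {1, 2, 3}\<close> in advance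
  (lemma \<open>infinity_elusive_kites\<close>). In the transfinite game Seeker does not know the roles, and must
  find them without using up the edges that may turn out irrelevant (lemma \<open>not_elusive_kites\<close>).
  For that she first picks the pairs of different parity only: they determine \<open>b\<close>, and among three
  far vertices two have the same parity, so that some pair within \<open>F\<close> stays white.
  Then the edges at \<open>b\<close> give \<open>F\<close>, and all the remaining edges except one \<open>p\<close> and one \<open>y\<close>
  tell her which of these two is irrelevant.
\<close>

section \<open>The property\<close>

definition nbrs :: "graph \<Rightarrow> nat \<Rightarrow> nat set" where
  "nbrs G v = {w. {v, w} \<in> G}"

definition far :: "graph \<Rightarrow> nat \<Rightarrow> nat set" where
  "far G b = - insert b (nbrs G b)"

text \<open>
  The finite degrees make the centre unique; a condition on degrees is chosen because
  changing one edge cannot affect it, so that edges between neighbours of \<open>b\<close> can be irrelevant.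
  The number of far vertices is fixed so that every edge at the centre is relevant.
\<close>

definition centre :: "graph \<Rightarrow> nat \<Rightarrow> bool" where
  "centre G b \<longleftrightarrow> card (far G b) = 3 \<and> (\<forall>v. v \<noteq> b \<longrightarrow> finite (nbrs G v))"

definition crosses :: "nat set \<Rightarrow> edge \<Rightarrow> bool" where
  "crosses F e \<longleftrightarrow> e \<inter> F \<noteq> {} \<and> \<not> e \<subseteq> F"

definition detached :: "nat set \<Rightarrow> graph \<Rightarrow> bool" where
  "detached F G \<longleftrightarrow> (\<forall>e \<in> G. e \<inter> F = {})"

definition tethered :: "nat \<Rightarrow> nat set \<Rightarrow> graph \<Rightarrow> bool" where
  "tethered b F G \<longleftrightarrow> (\<exists>!e. e \<in> G \<and> crosses F e) \<and> (\<forall>e \<in> G. b \<in> e \<or> e \<inter> F \<noteq> {})"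

text \<open>
  Detached graphs are indifferent to the edges that avoid \<open>b\<close> and \<open>F\<close>, tethered ones to the
  edges within \<open>F\<close>. The single edge that crosses the border of \<open>F\<close> is the tether of the kite.
\<close>

definition kites :: "graph set" where
  "kites = {G. G \<subseteq> edges \<and>
     (\<exists>b. centre G b \<and> (detached (far G b) G \<or> tethered b (far G b) G))}"

lemma edges_iff: "e \<in> edges \<longleftrightarrow> (\<exists>n k. n \<noteq> k \<and> e = {n, k})"
  by (auto simp: edges_def)

lemma pair_in_edges [simp]: "{n, k} \<in> edges \<longleftrightarrow> n \<noteq> k"
  by (auto simp: edges_iff doubleton_eq_iff)

lemma singleton_notin_edges [simp]: "{n} \<notin> edges"
  using pair_in_edges[of n n] by simp

lemma infinite_nbrs_centre: "centre G b \<Longrightarrow> infinite (nbrs G b)"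
proof
  assume c: "centre G b" and f: "finite (nbrs G b)"
  have "finite (far G b)" using c by (intro card_ge_0_finite) (simp add: centre_def)
  then have "finite (far G b \<union> insert b (nbrs G b))" using f by simp
  moreover have "far G b \<union> insert b (nbrs G b) = UNIV" by (auto simp: far_def)
  ultimately show False by (metis infinite_UNIV_nat)
qed

text \<open>
  The existential quantifier in the definition of kites can be instantiated with any vertex of
  infinite degree, since a centre is the only such vertex.
\<close>

lemma kitesD:
  assumes "G \<in> kites" "infinite (nbrs G b)"
  shows "centre G b" "detached (far G b) G \<or> tethered b (far G b) G"
proof -
  obtain c where c: "centre G c" "detached (far G c) G \<or> tethered c (far G c) G"
    using assms(1) by (auto simp: kites_def)
  have "c = b" using c(1) assms(2) by (auto simp: centre_def)
  then show "centre G b" "detached (far G b) G \<or> tethered b (far G b) G" using c by auto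
qed

lemma kitesI:
  assumes "G \<subseteq> edges" "centre G b" "detached (far G b) G \<or> tethered b (far G b) G"
  shows "G \<in> kites"
  unfolding kites_def using assms by blast

lemma graph_property_kites: "graph_property kites"
proof -
  have "(\<lambda>e. \<pi> ` e) ` G \<in> kites" if bij: "bij \<pi>" and G: "G \<in> kites" for \<pi> :: "nat \<Rightarrow> nat" and G
  proof -
    let ?H = "(\<lambda>e. \<pi> ` e) ` G"
    have inj: "inj \<pi>" using bij by (rule bij_is_inj)
    have img: "\<pi> ` e \<in> ?H \<longleftrightarrow> e \<in> G" for e
      using inj by (auto simp: inj_image_eq_iff)
    obtain b where b: "centre G b" "detached (far G b) G \<or> tethered b (far G b) G"
      and sub: "G \<subseteq> edges"
      using G by (auto simp: kites_def)
    have nb: "nbrs ?H (\<pi> v) = \<pi> ` nbrs G v" for v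
    proof (rule set_eqI)
      fix u
      obtain w where w: "u = \<pi> w" using bij by (metis bij_pointE)
      show "u \<in> nbrs ?H (\<pi> v) \<longleftrightarrow> u \<in> \<pi> ` nbrs G v"
        using img[of "{v, w}"] inj by (simp add: w nbrs_def inj_image_mem_iff)
    qed
    have far: "far ?H (\<pi> b) = \<pi> ` far G b"
      using bij by (simp add: far_def nb bij_image_Compl_eq)
    have "centre ?H (\<pi> b)"
      unfolding centre_def
    proof (intro conjI allI impI)
      show "card (far ?H (\<pi> b)) = 3"
        using b(1) inj by (simp add: far centre_def card_image inj_on_subset)
      fix v assume "v \<noteq> \<pi> b"
      moreover obtain w where "v = \<pi> w" using bij by (metis bij_pointE)
      ultimately show "finite (nbrs ?H v)" using b(1) by (auto simp: nb centre_def)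
    qed
    moreover have cr: "crosses (\<pi> ` F) (\<pi> ` e) \<longleftrightarrow> crosses F e" for F e
      using inj by (auto simp: crosses_def inj_image_subset_iff image_Int[symmetric])
    moreover have "detached (\<pi> ` far G b) ?H" if "detached (far G b) G"
      using that inj by (simp add: detached_def image_Int[symmetric])
    moreover have "tethered (\<pi> b) (\<pi> ` far G b) ?H" if t: "tethered b (far G b) G"
    proof -
      obtain e where e: "e \<in> G" "crosses (far G b) e"
        "\<And>d. d \<in> G \<Longrightarrow> crosses (far G b) d \<Longrightarrow> d = e"
        using t unfolding tethered_def by blast
      have "\<exists>!e. e \<in> ?H \<and> crosses (\<pi> ` far G b) e"
      proof (rule ex1I[of _ "\<pi> ` e"])
        show "\<pi> ` e \<in> ?H \<and> crosses (\<pi> ` far G b) (\<pi> ` e)"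
          using e(1,2) by (simp add: cr)
        fix d assume d: "d \<in> ?H \<and> crosses (\<pi> ` far G b) d"
        then obtain d' where "d' \<in> G" "d = \<pi> ` d'" by blast
        then show "d = \<pi> ` e" using d e(3)[of d'] by (simp add: cr)
      qed
      moreover have "\<pi> b \<in> \<pi> ` e \<or> \<pi> ` e \<inter> \<pi> ` far G b \<noteq> {}" if "e \<in> G" for e
        using t that inj
        by (auto simp: tethered_def inj_image_mem_iff simp flip: image_Int)
      then have "\<forall>d \<in> ?H. \<pi> b \<in> d \<or> d \<inter> \<pi> ` far G b \<noteq> {}" by blast
      ultimately show ?thesis unfolding tethered_def by (intro conjI)
    qed
    moreover have "?H \<subseteq> edges"
    proof
      fix e assume "e \<in> ?H"
      then obtain d where d: "d \<in> G" "e = \<pi> ` d" by blast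
      then have "d \<in> edges" using sub by blast
      then obtain n k where "n \<noteq> k" "d = {n, k}" unfolding edges_iff by blast
      then show "e \<in> edges" using inj d(2) by (simp add: inj_eq)
    qed
    ultimately show ?thesis using b(2) far by (metis kitesI)
  qed
  moreover have "kites \<subseteq> Pow edges" by (auto simp: kites_def)
  ultimately show ?thesis by (auto simp: graph_property_def)
qed

section \<open>Hider wins the infinite game\<close>

text \<open>
  The roles of the vertices are fixed: \<open>0\<close> is the centre and \<open>1, 2, 3\<close> are the far vertices.
  It does not harm Hider that Seeker's strategy may be built on this knowledge.
\<close>

abbreviation tail :: "nat set" where "tail \<equiv> {1, 2, 3}"

definition spokes :: graph where
  "spokes = {{0, w} | w. w > 3}"

text \<open>
  The edges between the far vertices and the neighbours of the centre; an edge from \<open>0\<close>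
  to a far vertex crosses the border of the far set too, but is not counted.
\<close>

definition bridge :: "edge \<Rightarrow> bool" where
  "bridge e \<longleftrightarrow> 0 \<notin> e \<and> crosses tail e"

definition tail_edges :: "edge set" where
  "tail_edges = {{1, 2}, {1, 3}, {2, 3}}"

text \<open>
  Hider draws the star around \<open>0\<close> and nothing else, until all edges within the far set are red.
  From then on these would be the irrelevant edges of a tethered graph, so the next bridge becomes
  the tether.
\<close>

definition hider :: "turn list \<Rightarrow> edge \<Rightarrow> colour" where
  "hider h e =
     (if e \<in> spokes \<or>
         (bridge e \<and> tail_edges \<subseteq> fst ` set h \<and> (\<forall>d. bridge d \<longrightarrow> (d, Green) \<notin> set h))
      then Green else Red)"

fun hider_history :: "strategy \<Rightarrow> nat \<Rightarrow> turn list" where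
  "hider_history \<sigma> 0 = []"
| "hider_history \<sigma> (Suc n) =
     hider_history \<sigma> n @ [(\<sigma> (hider_history \<sigma> n), hider (hider_history \<sigma> n) (\<sigma> (hider_history \<sigma> n)))]"

definition hider_play :: "strategy \<Rightarrow> nat \<Rightarrow> turn" where
  "hider_play \<sigma> n = (\<sigma> (hider_history \<sigma> n), hider (hider_history \<sigma> n) (\<sigma> (hider_history \<sigma> n)))"

lemma map_hider_play: "map (hider_play \<sigma>) [0..<n] = hider_history \<sigma> n"
  by (induction n) (simp_all add: hider_play_def)

lemma history_hider:
  assumes "legal \<sigma>" shows "history \<sigma> (hider_history \<sigma> n)"
proof (induction n)
  case (Suc n)
  then have "\<sigma> (hider_history \<sigma> n) \<in> white (set (hider_history \<sigma> n))"
    using assms by (auto simp: legal_def)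
  then show ?case using Suc by (auto simp: history_def nth_append less_Suc_eq)
qed (simp add: history_def)

lemma spokes_subset_edges: "spokes \<subseteq> edges"
  by (auto simp: spokes_def)

lemma nbrs_spokes: "nbrs spokes 0 = {3<..}" "v \<noteq> 0 \<Longrightarrow> nbrs spokes v \<subseteq> {0}"
  by (auto simp: nbrs_def spokes_def doubleton_eq_iff)

lemma finite_nbrs_if_finite:
  assumes "finite H" shows "finite (nbrs H v)"
proof (rule finite_subset)
  show "nbrs H v \<subseteq> {w. {v, w} \<in> H}" by (auto simp: nbrs_def)
  have "inj (\<lambda>w. {v, w})" by (auto simp: inj_def doubleton_eq_iff)
  then show "finite {w. {v, w} \<in> H}"
    using finite_vimageI[OF assms] by (simp add: vimage_def)
qed

lemma nbrs_Un: "nbrs (G \<union> H) v = nbrs G v \<union> nbrs H v"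
  by (auto simp: nbrs_def)

text \<open>
  Away from \<open>0\<close>, a finite set of edges changes neither the far set nor the finiteness of the
  degrees, so that only the detached or tethered condition remains to be looked at.
\<close>

lemma spokes_Un_in_kites_iff:
  assumes H: "H \<subseteq> edges" "finite H" "\<forall>e \<in> H. 0 \<notin> e"
  shows "spokes \<union> H \<in> kites \<longleftrightarrow>
    (\<forall>e \<in> H. e \<inter> tail = {}) \<or>
    (\<exists>!e. e \<in> H \<and> crosses tail e) \<and> (\<forall>e \<in> H. e \<inter> tail \<noteq> {})"
proof -
  let ?G = "spokes \<union> H"
  have nb: "nbrs ?G 0 = {3<..}" using H(3) by (auto simp: nbrs_Un nbrs_spokes) (auto simp: nbrs_def)
  have far: "far ?G 0 = tail" unfolding far_def nb by auto
  have fin: "finite (nbrs ?G v)" if "v \<noteq> 0" for v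
    using finite_subset[OF nbrs_spokes(2)[OF that]] finite_nbrs_if_finite[OF H(2)]
    by (simp add: nbrs_Un)
  have "card tail = 3" by simp
  then have c: "centre ?G 0" using fin by (auto simp: centre_def far)
  have sp: "e \<inter> tail = {}" "0 \<in> e" "\<not> crosses tail e" if "e \<in> spokes" for e
    using that by (auto simp: spokes_def crosses_def)
  have d: "detached tail ?G \<longleftrightarrow> (\<forall>e \<in> H. e \<inter> tail = {})"
    using sp unfolding detached_def by blast
  have t: "tethered 0 tail ?G \<longleftrightarrow>
      (\<exists>!e. e \<in> H \<and> crosses tail e) \<and> (\<forall>e \<in> H. e \<inter> tail \<noteq> {})"
  proof -
    have "e \<in> ?G \<and> crosses tail e \<longleftrightarrow> e \<in> H \<and> crosses tail e" for e
      using sp by blast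
    moreover have "(\<forall>e \<in> ?G. 0 \<in> e \<or> e \<inter> tail \<noteq> {}) \<longleftrightarrow> (\<forall>e \<in> H. e \<inter> tail \<noteq> {})"
      using sp(2) H(3) unfolding ball_Un by simp
    ultimately show ?thesis by (simp only: tethered_def)
  qed
  have "?G \<in> kites \<longleftrightarrow> detached tail ?G \<or> tethered 0 tail ?G"
    using kitesD[of ?G 0] kitesI[of ?G 0] infinite_nbrs_centre[OF c] c far H(1) spokes_subset_edges
    by auto
  then show ?thesis by (simp only: d t)
qed

lemma spokes_two_not_in_kites:
  assumes "d \<in> edges" "e \<in> edges" "0 \<notin> d" "0 \<notin> e" "d \<noteq> e"
    and d: "crosses tail d" and e: "crosses tail e \<or> e \<inter> tail = {}"
  shows "spokes \<union> {d, e} \<notin> kites"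
proof -
  have "\<not> (\<forall>a \<in> {d, e}. a \<inter> tail = {})" using d unfolding crosses_def by (metis insertI1)
  moreover have "\<not> ((\<exists>!a. a \<in> {d, e} \<and> crosses tail a) \<and> (\<forall>a \<in> {d, e}. a \<inter> tail \<noteq> {}))"
  proof
    assume *: "(\<exists>!a. a \<in> {d, e} \<and> crosses tail a) \<and> (\<forall>a \<in> {d, e}. a \<inter> tail \<noteq> {})"
    then have "e \<inter> tail \<noteq> {}" by simp
    then have "crosses tail e" using e by blast
    moreover obtain a where "\<And>c. c \<in> {d, e} \<Longrightarrow> crosses tail c \<Longrightarrow> c = a" using * by metis
    ultimately show False using d \<open>d \<noteq> e\<close> by (metis insert_iff)
  qed
  moreover have "{d, e} \<subseteq> edges" "finite {d, e}" "\<forall>a \<in> {d, e}. 0 \<notin> a" using assms by simp_all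
  ultimately show ?thesis using spokes_Un_in_kites_iff[of "{d, e}"] by simp
qed

lemma not_in_kites_if_card_far:
  assumes "infinite (nbrs G b)" "card (far G b) \<noteq> 3"
  shows "G \<notin> kites"
  using kitesD(1)[of G b] assms by (auto simp: centre_def)

text \<open>
  An edge at the centre moves its other end into or out of the far set, which then no longer
  has three elements.
\<close>

lemma centre_edge_relevant:
  assumes c: "centre G b" and w: "w \<noteq> b"
  shows "{b, w} \<in> G \<Longrightarrow> G - {{b, w}} \<notin> kites"
    and "{b, w} \<notin> G \<Longrightarrow> insert {b, w} G \<notin> kites"
proof -
  note inf = infinite_nbrs_centre[OF c]
  have card: "card (far G b) = 3" using c by (simp add: centre_def)
  then have fin: "finite (far G b)" by (intro card_ge_0_finite) simp
  show "G - {{b, w}} \<notin> kites" if "{b, w} \<in> G"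
  proof (rule not_in_kites_if_card_far[of _ b])
    have nb: "nbrs (G - {{b, w}}) b = nbrs G b - {w}"
      unfolding nbrs_def by (auto simp: doubleton_eq_iff)
    show "infinite (nbrs (G - {{b, w}}) b)" unfolding nb using inf by simp
    have "far (G - {{b, w}}) b = insert w (far G b)" unfolding far_def nb using w by auto
    moreover have "w \<notin> far G b" using that by (simp add: far_def nbrs_def)
    ultimately show "card (far (G - {{b, w}}) b) \<noteq> 3" using fin card by simp
  qed
  show "insert {b, w} G \<notin> kites" if "{b, w} \<notin> G"
  proof (rule not_in_kites_if_card_far[of _ b])
    have nb: "nbrs (insert {b, w} G) b = insert w (nbrs G b)"
      unfolding nbrs_def by (auto simp: doubleton_eq_iff)
    show "infinite (nbrs (insert {b, w} G) b)" unfolding nb using inf by simp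
    have "far (insert {b, w} G) b = far G b - {w}" unfolding far_def nb using w by auto
    moreover have "w \<in> far G b" using that w by (simp add: far_def nbrs_def)
    ultimately show "card (far (insert {b, w} G) b) \<noteq> 3" using fin card by simp
  qed
qed

lemma undecidedI:
  assumes "G \<in> completions T" "G \<in> S" "H \<in> completions T" "H \<notin> S"
  shows "\<not> decided S T"
  using assms by (auto simp: decided_def)

text \<open>
  If some edge within the far set stays white, no bridge is green, and this edge decides
  between the bare star and a graph that is neither detached nor tethered. Otherwise these edges are
  exhausted after finitely many turns. If a bridge is picked later, the star with the first such
  bridge is a tethered completion, for which no edge outside the far set is irrelevant. If none is,
  cofinitely many bridges are white, and they may or may not be present.
\<close>

lemma infinity_elusive_kites: "infinity_elusive kites"
  unfolding infinity_elusive_def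
proof
  assume "\<exists>\<sigma>. winning_strategy kites \<sigma>"
  then obtain \<sigma> where leg: "legal \<sigma>" and win: "\<And>p. play \<sigma> p \<Longrightarrow> decided kites (range p)"
    by (auto simp: winning_strategy_def)
  define h where "h = hider_history \<sigma>"
  define p where "p = hider_play \<sigma>"
  define T where "T = range p"
  have "play \<sigma> p"
    by (simp add: play_def p_def map_hider_play history_hider[OF leg])
  then have dec: "decided kites T" using win by (simp add: T_def)
  have p: "p n = (\<sigma> (h n), hider (h n) (\<sigma> (h n)))" for n
    by (simp add: p_def h_def hider_play_def)
  have set_h: "set (h n) = p ` {..<n}" for n
    by (simp add: h_def p_def flip: map_hider_play) auto
  have pick: "fst (p n) \<in> white (set (h n))" for n
    using leg history_hider[OF leg, of n] by (auto simp: p legal_def h_def)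
  have fst_neq: "fst (p m) \<noteq> fst (p n)" if "m < n" for m n
    using pick[of n] that by (auto simp: white_def set_h)
  then have inj: "m = n" if "fst (p m) = fst (p n)" for m n
    using that by (metis nat_neq_iff)
  have picked_edge: "fst (p n) \<in> edges" for n using pick by (auto simp: white_def)
  have green_pick: "hider (h n) e = Green" if eT: "(e, Green) \<in> T" "fst (p n) = e" for e n
  proof -
    obtain m where m: "p m = (e, Green)" using eT(1) unfolding T_def by (metis rangeE)
    then have "m = n" using inj[of m n] eT(2) by simp
    then show ?thesis using m p[of n] by (metis prod.inject)
  qed
  have green_rule: "e \<in> spokes \<or> bridge e \<and> tail_edges \<subseteq> fst ` set (h n) \<and>
      (\<forall>d. bridge d \<longrightarrow> (d, Green) \<notin> set (h n))"
    if "e \<in> green T" "fst (p n) = e" for e n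
    using green_pick[of e n] that unfolding green_def hider_def mem_Collect_eq
    by (metis colour.distinct(1))
  have picked: "\<exists>n. fst (p n) = e" if "e \<in> edges" "e \<notin> white T" for e
    using that by (auto simp: white_def T_def)
  have green_picked: "\<exists>n. fst (p n) = e" if "e \<in> green T" for e
  proof -
    have "(e, Green) \<in> range p" using that by (simp add: green_def T_def)
    then show ?thesis by (elim rangeE) (metis fst_conv)
  qed
  have green_spoke: "e \<in> green T" if e: "e \<in> spokes" "e \<notin> white T" for e
  proof -
    have "e \<in> edges" using e(1) spokes_subset_edges by blast
    then obtain n where n: "fst (p n) = e" using picked e(2) by blast
    then have "p n = (e, Green)" using e(1) by (auto simp: p hider_def)
    then show ?thesis unfolding green_def T_def mem_Collect_eq by (metis rangeI)
  qed
  have green_or: "e \<in> spokes \<or> bridge e" if "e \<in> green T" for e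
    using green_picked[OF that] green_rule[OF that] by blast
  have white_edges: "white T \<subseteq> edges" by (auto simp: white_def)
  have not_green_white: "e \<notin> green T" if "e \<in> white T" for e
    using that by (force simp: green_def white_def)
  have completion: "spokes \<union> H \<in> completions T"
    if "H \<subseteq> green T \<union> white T" "\<And>e. e \<in> green T \<Longrightarrow> bridge e \<Longrightarrow> e \<in> H" for H
    using that green_or green_spoke by (auto simp: completions_def)
  have tail_edges: "e \<in> edges" "0 \<notin> e" "e \<inter> tail \<noteq> {}" "\<not> crosses tail e" "\<not> bridge e"
    if "e \<in> tail_edges" for e
    using that by (auto simp: tail_edges_def crosses_def bridge_def)
  have spokes_in: "spokes \<in> kites" using spokes_Un_in_kites_iff[of "{}"] by simp
  show False
  proof (cases "\<exists>e \<in> tail_edges. e \<in> white T")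
    case True
    then obtain e where e: "e \<in> tail_edges" "e \<in> white T" by blast
    have no_bridge: "\<not> bridge d" if dg: "d \<in> green T" for d
    proof
      assume "bridge d"
      obtain n where n: "fst (p n) = d" using green_picked[OF dg] by blast
      have "d \<notin> spokes" using \<open>bridge d\<close> by (auto simp: spokes_def bridge_def)
      then have "tail_edges \<subseteq> fst ` set (h n)"
        using green_rule[OF dg n] by blast
      then show False using e by (auto simp: white_def T_def set_h)
    qed
    have "spokes \<union> {e} \<notin> kites"
      using spokes_Un_in_kites_iff[of "{e}"] tail_edges[OF e(1)] by auto
    then have "\<not> decided kites T"
      using undecidedI[of "spokes \<union> {}" T kites "spokes \<union> {e}"] completion[of "{}"]
        completion[of "{e}"] no_bridge e spokes_in by auto
    then show False using dec by blast
  next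
    case False
    then have "tail_edges \<subseteq> fst ` T" using tail_edges(1) by (auto simp: white_def)
    \<comment> \<open>Three edges are exhausted at a finite stage; here it matters that the far set is finite.\<close>
    then obtain N where N: "tail_edges \<subseteq> fst ` set (h N)"
    proof -
      assume *: "\<And>N. tail_edges \<subseteq> fst ` set (h N) \<Longrightarrow> thesis"
      have "finite tail_edges" by (simp add: tail_edges_def)
      with \<open>tail_edges \<subseteq> fst ` T\<close> obtain M where M: "finite M" "tail_edges \<subseteq> fst ` p ` M"
        unfolding T_def by (metis finite_subset_image image_mono order_refl image_image subset_UNIV)
      then have "M \<subseteq> {..<Suc (Max M)}" by (auto simp: less_Suc_eq_le)
      then show thesis using M(2) unfolding set_h
        by (intro *[of "Suc (Max M)"]) (unfold set_h, meson image_mono subset_trans)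
    qed
    show False
    proof (cases "\<exists>d \<in> green T. bridge d")
      case True
      then obtain d where d: "d \<in> green T" "bridge d" by blast
      have uniq: "d' = d" if d': "d' \<in> green T" "bridge d'" for d'
      proof -
        \<comment> \<open>At the later of two green bridges Hider would have noticed the earlier one.\<close>
        have *: False if "e \<in> green T" "bridge e" "e' \<in> green T" "bridge e'"
            "fst (p m) = e" "fst (p n) = e'" "m < n" for e e' m n
        proof -
          have "e' \<notin> spokes" using that by (auto simp: spokes_def bridge_def)
          then have "(e, Green) \<notin> set (h n)"
            using green_rule[OF that(3,6)] that(2) by blast
          moreover have "p m = (e, Green)"
            using green_pick[of e m] that p[of m] by (simp add: green_def)
          ultimately show False using that(7) unfolding set_h by (metis lessThan_iff imageI)
        qed
        obtain m n where "fst (p m) = d" "fst (p n) = d'" using d d' green_picked by metis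
        then show ?thesis using *[of d d' m n] *[of d' d n m] d d' by (metis nat_neq_iff)
      qed
      let ?G = "spokes \<union> {d}"
      have dd: "d \<in> edges" "0 \<notin> d" "crosses tail d" "d \<inter> tail \<noteq> {}" "\<not> d \<subseteq> tail"
        using d green_picked[OF d(1)] picked_edge by (auto simp: bridge_def crosses_def)
      have G: "?G \<in> kites" using spokes_Un_in_kites_iff[of "{d}"] dd by auto
      have Gc: "?G \<in> completions T"
      proof (rule completion)
        show "{d} \<subseteq> green T \<union> white T" using d(1) by simp
      qed (simp add: uniq)
      obtain e where e: "e \<in> white T" using dec unfolding decided_def by blast
      have ed: "e \<in> edges" using e white_edges by blast
      have "\<exists>H \<in> completions T. H \<notin> kites"
      proof (cases "0 \<in> e")
        case True
        obtain n k where nk: "n \<noteq> k" "e = {n, k}" using ed unfolding edges_iff by blast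
        obtain w where w: "e = {0, w}" "w \<noteq> 0"
          using True nk by (metis insertE insert_commute singletonD)
        have "nbrs ?G 0 = {3<..}"
        proof -
          have "nbrs {d} 0 = {}" using dd(2) by (auto simp: nbrs_def)
          then show ?thesis unfolding nbrs_Un nbrs_spokes by simp
        qed
        then have "centre ?G 0" using kitesD(1)[OF G] by (simp add: infinite_Ioi)
        note relevant = centre_edge_relevant[OF this w(2)]
        show ?thesis
        proof (cases "e \<in> ?G")
          case True
          moreover have "?G - {e} \<in> completions T"
            using Gc not_green_white[OF e] unfolding completions_def by blast
          ultimately show ?thesis using relevant(1) w(1) by blast
        next
          case False
          moreover have "insert e ?G \<in> completions T"
            using Gc e unfolding completions_def by blast
          ultimately show ?thesis using relevant(2) w(1) by blast
        qed
      next
        case False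
        have ne: "e \<noteq> d" using e d not_green_white by auto
        have "e \<notin> tail_edges" using \<open>\<not> (\<exists>e \<in> tail_edges. e \<in> white T)\<close> e by blast
        then have "crosses tail e \<or> e \<inter> tail = {}"
          using ed by (auto simp: edges_iff crosses_def tail_edges_def insert_commute)
        then have "spokes \<union> {d, e} \<notin> kites"
          using spokes_two_not_in_kites[OF dd(1) ed dd(2) False ne[symmetric] dd(3)] by blast
        moreover have "spokes \<union> {d, e} \<in> completions T"
        proof (rule completion)
          show "{d, e} \<subseteq> green T \<union> white T" using d(1) e by simp
        qed (simp add: uniq)
        ultimately show ?thesis by blast
      qed
      then show False using undecidedI[OF Gc G] dec by blast
    next
      case False
      have late: "\<not> bridge (fst (p n))" if "n \<ge> N" for n
      proof
        assume b: "bridge (fst (p n))"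
        have "(d, Green) \<notin> set (h n)" if "bridge d" for d
          using False that unfolding green_def set_h T_def by blast
        moreover have "tail_edges \<subseteq> fst ` set (h n)"
          using N \<open>n \<ge> N\<close> unfolding set_h by fastforce
        ultimately have "p n = (fst (p n), Green)" using b unfolding p hider_def by simp
        then have "(fst (p n), Green) \<in> range p" by (metis rangeI)
        then have "fst (p n) \<in> green T" unfolding green_def T_def by blast
        then show False using False b by blast
      qed
      \<comment> \<open>Beyond the vertices touched in the first \<open>N\<close> turns all bridges are white.\<close>
      have "finite (\<Union> (fst ` p ` {..<N}))"
        using picked_edge by (auto simp: edges_iff) (metis finite.emptyI finite.insertI)
      then obtain m where m: "\<And>v. v \<in> \<Union> (fst ` p ` {..<N}) \<Longrightarrow> v < m"
        by (metis finite_nat_set_iff_bounded)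
      have white: "{1, w} \<in> white T" if w: "w > m" "w > 3" for w
      proof (rule ccontr)
        assume nw: "{1, w} \<notin> white T"
        have "{1, w} \<in> edges" using w(2) by simp
        then obtain n where n: "fst (p n) = {1, w}" using picked nw by blast
        have "bridge {1, w}" using w(2) by (simp add: bridge_def crosses_def)
        then have "n < N" using late[of n] n by (metis not_le_imp_less)
        moreover have "w \<in> fst (p n)" by (simp add: n)
        ultimately have "w \<in> \<Union> (fst ` p ` {..<N})" by blast
        then show False using m[of w] w(1) by simp
      qed
      define e where "e = {1, m + 4}"
      define e' where "e' = {1, m + 5}"
      have e: "e \<in> white T" "e' \<in> white T" using white[of "m + 4"] white[of "m + 5"] by (simp_all add: e_def e'_def)
      have "e \<in> edges" "e' \<in> edges" "0 \<notin> e" "0 \<notin> e'" "e \<noteq> e'" "crosses tail e" "crosses tail e'"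
        by (simp_all add: e_def e'_def crosses_def doubleton_eq_iff)
      then have out: "spokes \<union> {e, e'} \<notin> kites" using spokes_two_not_in_kites by blast
      have "spokes \<union> {e, e'} \<in> completions T"
      proof (rule completion)
        show "{e, e'} \<subseteq> green T \<union> white T" using e by simp
      qed (use False in blast)
      moreover have "spokes \<union> {} \<in> completions T"
        by (rule completion) (use False in blast)+
      ultimately have "\<not> decided kites T" using undecidedI spokes_in out by (metis sup_bot_right)
      then show False using dec by blast
    qed
  qed
qed

section \<open>Seeker wins the transfinite game\<close>

text \<open>
  A strategy that looks only at the set of the turns played and is described by a target set:
  pick white edges of the target while there are any. The alternative keeps the
  strategy legal whatever the target is.
\<close>

definition aim :: "(turn set \<Rightarrow> edge set) \<Rightarrow> transfinite_strategy" where
  "aim K r =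
     (if K (Field r) \<inter> white (Field r) = {} then SOME e. e \<in> white (Field r)
      else SOME e. e \<in> K (Field r) \<inter> white (Field r))"

lemma transfinite_legal_aim: "transfinite_legal (aim K)"
  unfolding transfinite_legal_def
proof (intro allI impI)
  fix r :: "turn rel"
  assume "transfinite_history (aim K) r \<and> white (Field r) \<noteq> {}"
  then have "(SOME e. e \<in> white (Field r)) \<in> white (Field r)" by (simp add: some_in_eq)
  moreover have "(SOME e. e \<in> K (Field r) \<inter> white (Field r)) \<in> K (Field r) \<inter> white (Field r)"
    if "K (Field r) \<inter> white (Field r) \<noteq> {}" using that by (subst some_in_eq)
  ultimately show "aim K r \<in> white (Field r)" unfolding aim_def by auto
qed

lemma white_antimono: "A \<subseteq> B \<Longrightarrow> white B \<subseteq> white A"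
  by (auto simp: white_def)

lemma green_subset_fst: "green T \<subseteq> fst ` T"
  by (force simp: green_def)

lemma transfinite_history_edges:
  assumes "transfinite_history \<tau> r" "A \<subseteq> Field r" shows "fst ` A \<subseteq> edges"
  using assms unfolding transfinite_history_def white_def by blast

lemma transfinite_history_inj:
  assumes h: "transfinite_history \<tau> r" shows "inj_on fst (Field r)"
proof -
  have wo: "wo_rel r" using h by (simp add: transfinite_history_def wo_rel_def)
  have *: False if "t \<in> Field r" "u \<in> Field r" "fst t = fst u" "t \<noteq> u" "(t, u) \<in> r" for t u
  proof -
    have "t \<in> underS r u" using that by (simp add: underS_def)
    moreover have "fst u \<in> white (underS r u)"
      using h that(2) unfolding transfinite_history_def by blast
    ultimately show False using that(3) unfolding white_def by (metis DiffD2 imageI)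
  qed
  show ?thesis
  proof (rule inj_onI, rule ccontr)
    fix t u assume "t \<in> Field r" "u \<in> Field r" "fst t = fst u" "t \<noteq> u"
    then show False using wo_rel.TOTALS[OF wo] * by metis
  qed
qed

text \<open>An edge that has been coloured keeps its colour, because no edge is picked twice.\<close>

lemma green_agree:
  assumes "inj_on fst R" "A \<subseteq> T" "T \<subseteq> R" "e \<in> fst ` A"
  shows "e \<in> green T \<longleftrightarrow> e \<in> green A"
proof -
  obtain c where c: "(e, c) \<in> A" using assms(4) by auto
  have "c = Green" if "(e, Green) \<in> T"
    using inj_onD[OF assms(1), of "(e, c)" "(e, Green)"] c that assms(2,3) by auto
  then show ?thesis using c assms(2) by (auto simp: green_def)
qed

lemma completions_agree:
  assumes "G \<in> completions A" "e \<in> fst ` A"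
  shows "e \<in> G \<longleftrightarrow> e \<in> green A"
  using assms unfolding completions_def white_def by blast

text \<open>
  As long as the target is constantly \<open>E\<close>, Seeker works through \<open>E\<close>, however many turns this takes:
  there is an initial segment of the play after which exactly the edges of \<open>E\<close> have been added.
  It consists of \<open>A\<close> and the turns before which some edge of \<open>E\<close> was still white. That
  all later picks lie in \<open>E\<close> follows by transfinite induction, because the hypothesis on the target
  applies to a position only when the earlier picks are known to lie in \<open>E\<close>.
\<close>

lemma target_phase:
  assumes play: "transfinite_play (aim K) r" and A: "ofilter r A" and E: "E \<subseteq> edges"
    and target: "\<And>T. \<lbrakk>A \<subseteq> T; T \<subseteq> Field r; fst ` T \<subseteq> fst ` A \<union> E; E \<inter> white T \<noteq> {}\<rbrakk> \<Longrightarrow> K T = E"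
  shows "\<exists>B. ofilter r B \<and> A \<subseteq> B \<and> fst ` B = fst ` A \<union> E"
proof -
  have hist: "transfinite_history (aim K) r" and none: "white (Field r) = {}"
    using play by (auto simp: transfinite_play_def)
  have wo: "wo_rel r" using hist by (simp add: transfinite_history_def wo_rel_def)
  have turn: "fst t \<in> white (underS r t)" "fst t = aim K (Restr r (underS r t))" if "t \<in> Field r" for t
    using hist that unfolding transfinite_history_def by blast+
  define B where "B = A \<union> {t \<in> Field r. E \<inter> white (underS r t) \<noteq> {}}"
  have B: "ofilter r B"
    unfolding ofilter_def
  proof (intro conjI ballI)
    show "B \<subseteq> Field r" using A by (auto simp: B_def ofilter_def)
    fix t assume t: "t \<in> B"
    show "under r t \<subseteq> B"
    proof (cases "t \<in> A")
      case True
      then show ?thesis using A by (auto simp: B_def ofilter_def)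
    next
      case False
      then have t': "E \<inter> white (underS r t) \<noteq> {}" using t by (simp add: B_def)
      show ?thesis
      proof
        fix s assume "s \<in> under r t"
        then have s: "(s, t) \<in> r" by (simp add: under_def)
        then have "underS r s \<subseteq> underS r t" 
            by (rule underS_incr[OF wo_rel.TRANS[OF wo] wo_rel.ANTISYM[OF wo]])
        then have "white (underS r t) \<subseteq> white (underS r s)" by (rule white_antimono)
        then have "E \<inter> white (underS r s) \<noteq> {}" using t' by blast
        then show "s \<in> B" using s by (simp add: B_def FieldI1)
      qed
    qed
  qed
  have sub: "t \<in> B \<longrightarrow> fst t \<in> fst ` A \<union> E" for t
  proof (induction t rule: wo_rel.well_order_induct[OF wo])
    case (1 t)
    show ?case
    proof (intro impI)
      assume t: "t \<in> B"
      show "fst t \<in> fst ` A \<union> E"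
      proof (cases "t \<in> A")
        case False
        let ?T = "underS r t"
        have tF: "t \<in> Field r" and w: "E \<inter> white ?T \<noteq> {}" using t False by (simp_all add: B_def)
        have "A \<subseteq> ?T"
        proof
          fix a assume a: "a \<in> A"
          then have "(t, a) \<notin> r" using False A unfolding ofilter_def under_def by blast
          moreover have "a \<in> Field r" using a A unfolding ofilter_def by blast
          ultimately have "(a, t) \<in> r" using wo_rel.TOTALS[OF wo] tF by blast
          then show "a \<in> ?T" using a False by (auto simp: underS_def)
        qed
        moreover have TF: "?T \<subseteq> Field r" by (auto simp: underS_def Field_def)
        moreover have "?T \<subseteq> B" using t B unfolding ofilter_def underS_def under_def by blast
        then have "fst ` ?T \<subseteq> fst ` A \<union> E" using 1 unfolding underS_def by blast
        ultimately have K: "K ?T = E" using target w by blast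
        have "Field (Restr r ?T) = ?T" using wo_rel.REFL[OF wo] TF by (simp add: Refl_Field_Restr Int_absorb1)
        then have "fst t = (SOME e. e \<in> E \<inter> white ?T)"
          using turn(2)[OF tF] w unfolding aim_def K by (simp add: K)
        then have "fst t \<in> E \<inter> white ?T" using w by (metis some_in_eq)
        then show ?thesis by blast
      qed simp
    qed
  qed
  have "E \<subseteq> fst ` B"
  proof
    fix e assume e: "e \<in> E"
    then obtain t where t: "t \<in> Field r" "fst t = e" using none E unfolding white_def by blast
    then have "E \<inter> white (underS r t) \<noteq> {}" using turn(1)[of t] e by blast
    then have "t \<in> B" using t(1) by (simp add: B_def)
    then show "e \<in> fst ` B" using t by blast
  qed
  moreover have "A \<subseteq> B" by (simp add: B_def)
  moreover have "fst ` B \<subseteq> fst ` A \<union> E" using sub by blast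
  ultimately have "fst ` B = fst ` A \<union> E" by blast
  then show ?thesis using B \<open>A \<subseteq> B\<close> by blast
qed

text \<open>
  The complete bipartite graph between even and odd numbers. It is dense enough to show which vertex has
  infinite degree, and it has no triangle, so it leaves white a pair among any three vertices.
\<close>

definition mixed :: "edge set" where
  "mixed = {{n, k} | n k. odd (n + k)}"

definition star :: "nat \<Rightarrow> edge set" where
  "star b = {{b, w} | w. w \<noteq> b}"

text \<open>
  The centre and its far set as they appear in the current position. As long as a kite is a possible
  outcome, the hub does not change any more once the mixed edges have been coloured, nor does the far
  set once the edges at the hub have been coloured too.
\<close>

definition hub :: "turn set \<Rightarrow> nat" where
  "hub T = (THE b. infinite (nbrs (green T \<inter> mixed) b))"

definition far_hub :: "turn set \<Rightarrow> nat set" where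
  "far_hub T = far (green T) (hub T)"

text \<open>
  The two candidates for the irrelevant edge. They are chosen as functions of the centre and the
  far set alone, so that Seeker sticks to them during the play, and among the edges that are not mixed, so
  that they are still white when the far set becomes known.
\<close>

definition inner :: "nat set \<Rightarrow> edge" where
  "inner F = (SOME e. e \<in> edges - mixed \<and> e \<subseteq> F)"

definition outer :: "nat set \<Rightarrow> edge" where
  "outer F = (SOME e. e \<in> edges - mixed \<and> e \<inter> F = {})"

text \<open>
  The last line answers the question that the two candidates leave open: if some edge leaves the
  far set, the graph cannot be detached and the inner edge is irrelevant, otherwise it cannot be
  tethered and the outer edge is.
\<close>

definition target :: "turn set \<Rightarrow> edge set" where
  "target T =
    (if mixed \<inter> white T \<noteq> {} then mixed
     else if star (hub T) \<inter> white T \<noteq> {} then star (hub T)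
     else let p = inner (far_hub T); y = outer (insert (hub T) (far_hub T)) in
       if (edges - {p, y}) \<inter> white T \<noteq> {} then edges - {p, y}
       else if \<exists>e \<in> green T. crosses (far_hub T) e then {y} else {p})"

lemma mixed_iff [simp]: "{n, k} \<in> mixed \<longleftrightarrow> odd (n + k)"
  by (auto simp: mixed_def doubleton_eq_iff)

lemma mixed_subset_edges: "mixed \<subseteq> edges"
  by (auto simp: mixed_def)

lemma star_subset_edges: "star b \<subseteq> edges"
  by (auto simp: star_def)

lemma inner_edge:
  assumes "card F = 3" shows "inner F \<in> edges - mixed" "inner F \<subseteq> F"
proof -
  obtain x y z where F: "F = {x, y, z}" "x \<noteq> y" "y \<noteq> z" "x \<noteq> z"
    using assms by (metis card_3_iff)
  have "even (x + y) \<or> even (y + z) \<or> even (x + z)" by auto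
  then have "\<exists>e. e \<in> edges - mixed \<and> e \<subseteq> F"
  proof (elim disjE)
    assume "even (x + y)" then show ?thesis using F by (intro exI[of _ "{x, y}"]) simp
  next
    assume "even (y + z)" then show ?thesis using F by (intro exI[of _ "{y, z}"]) simp
  next
    assume "even (x + z)" then show ?thesis using F by (intro exI[of _ "{x, z}"]) simp
  qed
  then have "inner F \<in> edges - mixed \<and> inner F \<subseteq> F" unfolding inner_def by (rule someI_ex)
  then show "inner F \<in> edges - mixed" "inner F \<subseteq> F" by blast+
qed

lemma outer_edge:
  assumes "finite F" shows "outer F \<in> edges - mixed" "outer F \<inter> F = {}"
proof -
  obtain m where m: "\<And>n. n \<in> F \<Longrightarrow> n < m"
    using assms by (metis finite_nat_set_iff_bounded)
  have "m \<notin> F" using m[of m] by blast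
  moreover have "m + 2 \<notin> F" using m[of "m + 2"] by auto
  ultimately have "\<exists>e. e \<in> edges - mixed \<and> e \<inter> F = {}"
    by (intro exI[of _ "{m, m + 2}"]) simp
  then have "outer F \<in> edges - mixed \<and> outer F \<inter> F = {}" unfolding outer_def by (rule someI_ex)
  then show "outer F \<in> edges - mixed" "outer F \<inter> F = {}" by blast+
qed

text \<open>
  The centre is adjacent to all but finitely many vertices, in particular to infinitely many of
  the opposite parity.
\<close>

lemma hub_eq:
  assumes c: "centre G b" and G: "\<And>e. e \<in> mixed \<Longrightarrow> e \<in> G \<longleftrightarrow> e \<in> green T"
  shows "hub T = b"
proof -
  have GT: "green T \<inter> mixed = G \<inter> mixed" using G by blast
  have nb: "nbrs (G \<inter> mixed) v = nbrs G v \<inter> {w. odd (v + w)}" for v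
    by (auto simp: nbrs_def)
  have "infinite (nbrs (G \<inter> mixed) b)"
  proof
    assume "finite (nbrs (G \<inter> mixed) b)"
    moreover have "finite (far G b)"
      using c by (intro card_ge_0_finite) (simp add: centre_def)
    moreover have "{w. odd (b + w)} \<subseteq> nbrs (G \<inter> mixed) b \<union> insert b (far G b)"
      unfolding nb by (auto simp: far_def)
    ultimately have "finite {w. odd (b + w)}" by (meson finite_UnI finite_insert finite_subset)
    moreover have "range (\<lambda>n. b + 2 * n + 1) \<subseteq> {w. odd (b + w)}" by auto
    moreover have "infinite (range (\<lambda>n. b + 2 * n + 1))"
      by (subst finite_image_iff) (auto simp: inj_on_def)
    ultimately show False using finite_subset by blast
  qed
  moreover have "finite (nbrs (G \<inter> mixed) v)" if "v \<noteq> b" for v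
    using c that unfolding nb centre_def by blast
  ultimately show ?thesis unfolding hub_def GT by (intro the_equality) blast+
qed

lemma far_hub_eq:
  assumes c: "centre G b" and G: "\<And>e. e \<in> mixed \<union> star b \<Longrightarrow> e \<in> G \<longleftrightarrow> e \<in> green T"
  shows "far_hub T = far G b"
proof -
  have "hub T = b" by (rule hub_eq[OF c]) (use G in blast)
  moreover have "{b, w} \<in> green T \<longleftrightarrow> {b, w} \<in> G" if "w \<noteq> b" for w
    using that G[of "{b, w}"] by (auto simp: star_def)
  then have "far (green T) b = far G b" by (auto simp: far_def nbrs_def)
  ultimately show ?thesis by (simp add: far_hub_def)
qed

text \<open>
  The centre, its far set and the finiteness of the degrees survive a change of \<open>d\<close>.
  The existence of a crossing edge decides which of the two alternatives can hold at all,
  and in either case \<open>d\<close> is of the kind that this alternative ignores.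
\<close>

lemma irrelevant_edge:
  assumes G: "G \<in> kites" and c: "centre G b" and H: "H \<subseteq> edges"
    and GH: "\<And>e. e \<noteq> d \<Longrightarrow> e \<in> H \<longleftrightarrow> e \<in> G" and d: "d \<in> edges" "b \<notin> d"
    and cases: "d \<subseteq> far G b \<and> (\<exists>e \<in> G. crosses (far G b) e) \<or>
      d \<inter> far G b = {} \<and> (\<forall>e \<in> G. \<not> crosses (far G b) e)"
  shows "H \<in> kites"
proof -
  let ?F = "far G b"
  obtain n k where nk: "d = {n, k}" using d(1) unfolding edges_iff by blast
  have "{b, w} \<in> H \<longleftrightarrow> {b, w} \<in> G" for w using GH[of "{b, w}"] d(2) by blast
  then have far: "far H b = ?F" by (simp add: far_def nbrs_def)
  have "finite (nbrs H v)" if "v \<noteq> b" for v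
  proof (rule finite_subset)
    show "nbrs H v \<subseteq> nbrs G v \<union> d" using GH by (auto simp: nbrs_def)
    show "finite (nbrs G v \<union> d)" using c that by (simp add: centre_def nk)
  qed
  then have cH: "centre H b" using c by (simp add: centre_def far)
  have dt: "detached ?F G \<or> tethered b ?F G" using kitesD(2)[OF G infinite_nbrs_centre[OF c]] .
  have "detached ?F H \<or> tethered b ?F H"
    using cases
  proof (elim disjE conjE)
    assume dF: "d \<subseteq> ?F" and ex: "\<exists>e \<in> G. crosses ?F e"
    then have "\<not> detached ?F G" unfolding detached_def crosses_def by blast
    then have t: "tethered b ?F G" using dt by blast
    have "d \<inter> ?F \<noteq> {}" "\<not> crosses ?F d" using dF nk by (auto simp: crosses_def)
    then have "e \<in> H \<and> crosses ?F e \<longleftrightarrow> e \<in> G \<and> crosses ?F e" for e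
      using GH[of e] by (cases "e = d") simp_all
    moreover have "\<forall>e \<in> H. b \<in> e \<or> e \<inter> ?F \<noteq> {}"
    proof
      fix e assume "e \<in> H"
      then have "e = d \<or> e \<in> G" using GH by blast
      moreover have "\<forall>e \<in> G. b \<in> e \<or> e \<inter> ?F \<noteq> {}"
        using t unfolding tethered_def by (rule conjunct2)
      ultimately show "b \<in> e \<or> e \<inter> ?F \<noteq> {}" using \<open>d \<inter> ?F \<noteq> {}\<close> by blast
    qed
    ultimately have "tethered b ?F H" using t unfolding tethered_def by simp
    then show ?thesis ..
  next
    assume dF: "d \<inter> ?F = {}" and "\<forall>e \<in> G. \<not> crosses ?F e"
    then have "\<not> tethered b ?F G" unfolding tethered_def by (metis (no_types))
    then have "detached ?F G" using dt by blast
    then have "detached ?F H" using GH dF unfolding detached_def by metis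
    then show ?thesis ..
  qed
  then show ?thesis using kitesI[OF H cH] far by simp
qed

lemma undecidedE:
  assumes "\<not> decided S A" "white A \<noteq> {}" "fst ` A \<subseteq> edges"
  obtains G H where "G \<in> completions A" "G \<in> S" "H \<in> completions A" "H \<notin> S"
    "G \<subseteq> edges" "H \<subseteq> edges"
proof -
  have "green A \<union> white A \<subseteq> edges" using assms(3) by (force simp: green_def white_def)
  then have "G \<subseteq> edges" if "G \<in> completions A" for G using that unfolding completions_def by blast
  then show thesis using assms(1,2) that unfolding decided_def by blast
qed

text \<open>
  A play in which no position is decided is followed through four phases, ending in the initial
  segments \<open>A1\<close> to \<open>A4\<close>. That these positions are undecided is used as information: each of
  them has a completion that is a kite, and its centre and far set must be those that the coloured
  edges show. Finally \<open>A4\<close> leaves a single edge \<open>u\<close> white, and \<open>u\<close> is irrelevant, so \<open>A4\<close> is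
  decided after all.
\<close>

lemma not_elusive_kites: "\<not> elusive kites"
proof -
  have "\<exists>A. ofilter r A \<and> decided kites A" if play: "transfinite_play (aim target) r" for r
  proof (rule ccontr)
    assume "\<not> ?thesis"
    then have undecided: "\<not> decided kites A" if "ofilter r A" for A using that by blast
    have hist: "transfinite_history (aim target) r" using play by (simp add: transfinite_play_def)
    have wo: "wo_rel r" using hist by (simp add: transfinite_history_def wo_rel_def)
    have Field: "A \<subseteq> Field r" if "ofilter r A" for A
      using that by (simp add: ofilter_def)
    note inj = transfinite_history_inj[OF hist]
    note fst_edges = transfinite_history_edges[OF hist]
    have agree: "e \<in> G \<longleftrightarrow> e \<in> green T"
      if "G \<in> completions A" "e \<in> fst ` A" "A \<subseteq> T" "T \<subseteq> Field r" for G A e T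
      using completions_agree[OF that(1,2)] green_agree[OF inj that(3,4,2)] by simp
    have kite: "\<exists>G H b. G \<in> completions A \<and> G \<in> kites \<and> centre G b \<and> H \<in> completions A \<and>
        H \<notin> kites \<and> G \<subseteq> edges \<and> H \<subseteq> edges"
      if A: "ofilter r A" "white A \<noteq> {}" for A
    proof -
      obtain G H where "G \<in> completions A" "G \<in> kites" "H \<in> completions A" "H \<notin> kites"
          "G \<subseteq> edges" "H \<subseteq> edges"
        using undecidedE[OF undecided[OF A(1)] A(2) fst_edges[OF Field[OF A(1)]]] .
      moreover obtain b where "centre G b" using \<open>G \<in> kites\<close> by (auto simp: kites_def)
      ultimately show ?thesis by blast
    qed

    have empty: "ofilter r {}" by (simp add: ofilter_def)
    have "\<exists>B. ofilter r B \<and> {} \<subseteq> B \<and> fst ` B = fst ` ({} :: turn set) \<union> mixed"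
      by (rule target_phase[OF play empty mixed_subset_edges]) (simp add: target_def)
    then obtain A1 where A1: "ofilter r A1" and A1_mixed: "fst ` A1 = mixed" by auto
    \<comment> \<open>An undecided position must have a white edge; two vertices of equal parity provide it.\<close>
    have "{0, 2} \<in> white A1" unfolding white_def A1_mixed by simp
    then obtain G1 b where G1: "G1 \<in> completions A1" "centre G1 b"
      using kite[OF A1] by blast
    have hub: "hub T = b" if "A1 \<subseteq> T" "T \<subseteq> Field r" for T
      by (rule hub_eq[OF G1(2)], rule agree[OF G1(1) _ that], simp add: A1_mixed)

    have target1: "target T = star b"
      if "A1 \<subseteq> T" "T \<subseteq> Field r" "star b \<inter> white T \<noteq> {}" for T
    proof -
      have "mixed \<inter> white T = {}" using that(1) A1_mixed unfolding white_def by blast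
      then show ?thesis using that(3) hub[OF that(1,2)] unfolding target_def by simp
    qed
    have "\<exists>B. ofilter r B \<and> A1 \<subseteq> B \<and> fst ` B = fst ` A1 \<union> star b"
      by (rule target_phase[OF play A1 star_subset_edges]) (rule target1)
    then obtain A2 where A2: "ofilter r A2" "A1 \<subseteq> A2" "fst ` A2 = fst ` A1 \<union> star b" by blast
    then have A2_edges: "fst ` A2 = mixed \<union> star b" using A1_mixed by simp
    have "{b + 1, b + 3} \<in> white A2"
      unfolding white_def A2_edges by (auto simp: star_def doubleton_eq_iff)
    then obtain G2 c where G2: "G2 \<in> completions A2" "centre G2 c"
      using kite[OF A2(1)] by blast
    have "hub A2 = c"
      by (rule hub_eq[OF G2(2)], rule agree[OF G2(1) _ order_refl Field[OF A2(1)]])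
        (simp add: A2_edges)
    then have cb: "c = b" using hub[OF A2(2) Field[OF A2(1)]] by simp
    define F where "F = far G2 b"
    have F: "card F = 3" "b \<notin> F" using G2(2) cb by (auto simp: F_def centre_def far_def)
    have finF: "finite F" using F(1) by (intro card_ge_0_finite) simp
    have rim: "far_hub T = F" if "A2 \<subseteq> T" "T \<subseteq> Field r" for T
      unfolding F_def
      by (rule far_hub_eq[OF G2(2)[unfolded cb]], rule agree[OF G2(1) _ that], simp add: A2_edges)
    have kite2: "centre G b \<and> far G b = F"
      if "G \<in> completions T" "centre G c" "A2 \<subseteq> T" "T \<subseteq> Field r" for G T c
    proof -
      have *: "e \<in> G \<longleftrightarrow> e \<in> green T" if "e \<in> mixed \<union> star b" for e
      proof (rule agree[OF \<open>G \<in> completions T\<close> _ order_refl \<open>T \<subseteq> Field r\<close>])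
        show "e \<in> fst ` T"
          using that A2_edges image_mono[OF \<open>A2 \<subseteq> T\<close>, of fst] by blast
      qed
      have "hub T = c" by (rule hub_eq[OF that(2)], rule *, simp)
      then have "c = b" using hub[OF order_trans[OF A2(2) that(3)] that(4)] by simp
      then have "centre G b" using that(2) by simp
      moreover from this have "far_hub T = far G b" using * by (rule far_hub_eq)
      ultimately show ?thesis using rim[OF that(3,4)] by simp
    qed

    define p where "p = inner F"
    define y where "y = outer (insert b F)"
    have p: "p \<in> edges" "p \<notin> mixed" "p \<subseteq> F" using inner_edge[OF F(1)] by (auto simp: p_def)
    have y: "y \<in> edges" "y \<notin> mixed" "y \<inter> insert b F = {}"
      using outer_edge[of "insert b F"] finF by (auto simp: y_def)
    have bp: "b \<notin> p" using p(3) F(2) by blast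
    have yb: "b \<notin> y" "y \<inter> F = {}" using y(3) by blast+
    have "p \<noteq> {}" using p(1) by (auto simp: edges_iff)
    then have py: "p \<noteq> y" using p(3) yb(2) by blast
    have target2: "target T = (if (edges - {p, y}) \<inter> white T \<noteq> {} then edges - {p, y}
       else if \<exists>e \<in> green T. crosses F e then {y} else {p})"
      if "A2 \<subseteq> T" "T \<subseteq> Field r" for T
    proof -
      have "mixed \<inter> white T = {}" "star b \<inter> white T = {}"
        using that(1) A2_edges unfolding white_def by blast+
      moreover have "hub T = b" by (rule hub[OF order_trans[OF A2(2) that(1)] that(2)])
      ultimately show ?thesis
        unfolding target_def Let_def rim[OF that] p_def y_def by simp
    qed
    have "\<exists>B. ofilter r B \<and> A2 \<subseteq> B \<and> fst ` B = fst ` A2 \<union> (edges - {p, y})"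
      by (rule target_phase[OF play A2(1) Diff_subset]) (simp add: target2)
    then obtain A3 where A3: "ofilter r A3" "A2 \<subseteq> A3"
        "fst ` A3 = fst ` A2 \<union> (edges - {p, y})" by blast
    have "p \<notin> star b" "y \<notin> star b" using bp yb by (auto simp: star_def)
    then have A3_edges: "fst ` A3 = edges - {p, y}"
      unfolding A3(3) A2_edges using p(2) y(2) mixed_subset_edges star_subset_edges[of b] by blast

    \<comment> \<open>Only \<open>p\<close> and \<open>y\<close> are white: \<open>d\<close> is the edge still to be picked, \<open>u\<close> the one left.\<close>
    define crossed where "crossed \<longleftrightarrow> (\<exists>e \<in> green A3. crosses F e)"
    define d where "d = (if crossed then y else p)"
    define u where "u = (if crossed then p else y)"
    have du: "d \<in> edges" "u \<in> edges" "b \<notin> u" "{p, y} = {d, u}" "d \<noteq> u"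
      using p(1) y(1) bp yb(1) py by (auto simp: d_def u_def)
    have target3: "target T = {d}"
      if T: "A3 \<subseteq> T" "T \<subseteq> Field r" "fst ` T \<subseteq> fst ` A3 \<union> {d}" "{d} \<inter> white T \<noteq> {}" for T
    proof -
      have "(edges - {p, y}) \<inter> white T = {}"
      proof -
        have "white A3 \<subseteq> {p, y}" unfolding white_def A3_edges by blast
        then show ?thesis using white_antimono[OF T(1)] by blast
      qed
      moreover have "green T = green A3"
      proof (rule set_eqI)
        fix e
        have "d \<notin> fst ` T" using T(4) by (simp add: white_def)
        then have "fst ` T \<subseteq> fst ` A3" using T(3) by blast
        then have "e \<in> fst ` A3" if "e \<in> green T \<or> e \<in> green A3"
          using that subsetD[OF green_subset_fst[of T]] subsetD[OF green_subset_fst[of A3]] by auto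
        then show "e \<in> green T \<longleftrightarrow> e \<in> green A3" using green_agree[OF inj T(1,2)] by metis
      qed
      ultimately show ?thesis
        using target2[OF order_trans[OF A3(2) T(1)] T(2)] by (simp add: d_def crossed_def)
    qed
    have "\<exists>B. ofilter r B \<and> A3 \<subseteq> B \<and> fst ` B = fst ` A3 \<union> {d}"
      by (rule target_phase[OF play A3(1)]) (simp add: du(1), rule target3)
    then obtain A4 where A4: "ofilter r A4" "A3 \<subseteq> A4" "fst ` A4 = fst ` A3 \<union> {d}" by blast
    have A4_edges: "fst ` A4 = edges - {u}"
      unfolding A4(3) A3_edges du(4) using du(1,5) by blast
    then have "u \<in> white A4" using du(2) by (simp add: white_def)
    then obtain G H c where G: "G \<in> completions A4" "G \<in> kites" "centre G c" "G \<subseteq> edges"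
      and H: "H \<in> completions A4" "H \<notin> kites" "H \<subseteq> edges"
      using kite[OF A4(1)] by blast
    have A24: "A2 \<subseteq> A4" by (rule order_trans[OF A3(2) A4(2)])
    note Gb = kite2[OF G(1,3) A24 Field[OF A4(1)]]
    have GH: "e \<in> H \<longleftrightarrow> e \<in> G" if "e \<noteq> u" for e
    proof (cases "e \<in> edges")
      case True
      then show ?thesis
        using completions_agree[OF G(1), of e] completions_agree[OF H(1), of e] that
        by (simp add: A4_edges)
    qed (use G(4) H(3) in blast)
    \<comment> \<open>Neither \<open>p\<close> nor \<open>y\<close> crosses the border of \<open>F\<close>, so \<open>A3\<close> shows all crossing edges.\<close>
    have crossG: "crossed \<longleftrightarrow> (\<exists>e \<in> G. crosses F e)"
    proof
      assume crossed
      then obtain e where e: "e \<in> green A3" "crosses F e" by (auto simp: crossed_def)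
      then have "e \<in> G" using G(1) A4(2) by (auto simp: completions_def green_def)
      then show "\<exists>e \<in> G. crosses F e" using e(2) by blast
    next
      assume "\<exists>e \<in> G. crosses F e"
      then obtain e where e: "e \<in> G" "crosses F e" by blast
      show crossed
      proof (rule ccontr)
        assume "\<not> crossed"
        moreover have "\<not> crosses F p" "\<not> crosses F y" using p(3) yb(2) by (auto simp: crosses_def)
        then have "e \<in> fst ` A3" using e G(4) unfolding A3_edges by blast
        then have "e \<in> green A3"
          using completions_agree[OF G(1), of e] e(1) A4(3)
            green_agree[OF inj A4(2) Field[OF A4(1)], of e] by simp
        ultimately show False using e(2) by (auto simp: crossed_def)
      qed
    qed
    have "u \<subseteq> F \<and> (\<exists>e \<in> G. crosses F e) \<or> u \<inter> F = {} \<and> (\<forall>e \<in> G. \<not> crosses F e)"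
      using crossG p(3) yb(2) by (auto simp: u_def)
    then have "H \<in> kites"
      using irrelevant_edge[OF G(2) conjunct1[OF Gb] H(3) GH du(2,3)] Gb by simp
    then show False using H(2) by blast
  qed
  then have "transfinite_winning_strategy kites (aim target)"
    using transfinite_legal_aim by (auto simp: transfinite_winning_strategy_def)
  then show ?thesis by (auto simp: elusive_def)
qed

theorem theorem5p1:
  shows "\<exists>S\<^sub>0. graph_property S\<^sub>0 \<and> infinity_elusive S\<^sub>0 \<and> \<not> elusive S\<^sub>0"
  using graph_property_kites infinity_elusive_kites not_elusive_kites by blast

end
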